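(* Let $m\in(0,1]$, let $h:J\subseteq\mathbb{R}\to\mathbb{R}$ be a non-negative function, and let $f:[0,\infty)\to\mathbb{R}$ be an $(h-m)$-convex function. If $0\le a<b<\infty$ and $f\in L_1[ma,b]$, then $$\frac{1}{m+1}\left[\frac{1}{mb-a}\int_a^{mb} f(x)\,dx+\frac{1}{b-ma}\int_{ma}^{b} f(x)\,dx\right]\le \frac{f(a)+f(b)}{2}\left[\int_0^1 h(t)\,dt+\int_0^1 h(1-t)\,dt\right].$$
   Context: Let $h:J\subseteq\mathbb{R}\to\mathbb{R}$ be a non-negative function, where $J$ is an interval containing $(0,1)$, and let $m\in[0,1]$. A function $f$ defined on $[0,\infty)$ is called $(h-m)$-convex if $f$ is non-negative and for all $x,y\in[0,\infty)$ and all $\alpha\in(0,1)$, $$f(\alpha x+m(1-\alpha)y)\le h(\alpha)f(x)+m\,h(1-\alpha)f(y).$$ Writing $\int_0^1 h(t)\,dt$ presupposes that $h$ is Lebesgue integrable on $(0,1)$, and writing $\frac{1}{mb-a}$ presupposes $mb\neq a$. If $mb<a$, the integral $\int_a^{mb}$ is the usual oriented integral $-\int_{mb}^a$. *)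

theory Defs
  imports "HOL-Analysis.Analysis"
begin

(* A function on [0, infinity) is a total function on the reals of which only the
   values at non-negative arguments are used; likewise h matters only on (0,1). *)
definition hm_convex :: "(real \<Rightarrow> real) \<Rightarrow> real \<Rightarrow> (real \<Rightarrow> real) \<Rightarrow> bool" where
  "hm_convex h m f \<longleftrightarrow>
     (\<forall>x\<in>{0..}. 0 \<le> f x) \<and>
     (\<forall>x\<in>{0..}. \<forall>y\<in>{0..}. \<forall>\<alpha>\<in>{0<..<1}.
        f (\<alpha> * x + m * (1 - \<alpha>) * y) \<le> h \<alpha> * f x + m * h (1 - \<alpha>) * f y)"

end

theory Submission
  imports Defs
begin

text \<open>Along the segment from \<open>x\<close> to \<open>m * y\<close>, the convexity inequality reads
  \<open>f ((1 - t) * x + t * (m * y)) \<le> h (1 - t) * f x + m * h t * f y\<close>. Integrating over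
  \<open>t\<close> turns the left side into the mean value of \<open>f\<close> on the segment, and the right side
  into \<open>H * (f x + m * f y)\<close>, where \<open>H\<close> is the common value of the integrals of \<open>h t\<close>
  and \<open>h (1 - t)\<close> over the unit interval. This is lemma \<open>hm_convex_mean_le\<close>. Its instances
  for \<open>(x, y) = (a, b)\<close> and \<open>(x, y) = (b, a)\<close> have right sides with sum
  \<open>(m + 1) * H * (f a + f b)\<close>, which gives the theorem after division by \<open>m + 1\<close>.

  The mean value \<open>1 / (d - c) * (LINT x=c..d|lebesgue. f x)\<close> is symmetric in \<open>c\<close> and \<open>d\<close>,
  because the oriented integral and the factor change sign together. So \<open>a < m * b\<close> and
  \<open>m * b < a\<close> are told apart only in the substitution \<open>has_integral_along_segment\<close>.\<close>

lemma mean_value_swap: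
  fixes f :: "real \<Rightarrow> real" and c d :: real
  shows "1 / (d - c) * (LINT x=c..d|lebesgue. f x) = 1 / (c - d) * (LINT x=d..c|lebesgue. f x)"
proof -
  have "1 / (d - c) = - (1 / (c - d))"
    by (metis minus_diff_eq minus_divide_right)
  then show ?thesis
    by (cases c d rule: linorder_cases) (simp_all add: interval_lebesgue_integral_def)
qed

lemma has_integral_oriented_lebesgue:
  fixes f :: "real \<Rightarrow> real" and c d :: real
  assumes "c \<le> d" and f: "f absolutely_integrable_on {c<..<d}"
  shows "(f has_integral (LINT x=c..d|lebesgue. f x)) {c..d}"
proof -
  have "(LINT x=c..d|lebesgue. f x) = (LINT x:{c<..<d}|lebesgue. f x)"
    using assms(1) by (simp add: interval_lebesgue_integral_le_eq)
  also have "\<dots> = integral {c<..<d} f"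
    by (rule set_lebesgue_integral_eq_integral(2)[OF f])
  finally have "(f has_integral (LINT x=c..d|lebesgue. f x)) {c<..<d}"
    using set_lebesgue_integral_eq_integral(1)[OF f] by (simp add: has_integral_integrable_integral)
  then show ?thesis
    by (simp add: has_integral_Icc_iff_Ioo)
qed

text \<open>Affine substitution: the mean value of \<open>f\<close> on a segment is the integral over
  \<open>{0..1}\<close> of \<open>f\<close> along the parametrisation of the segment. Stating it for the
  Henstock--Kurzweil integral makes integrability of the composed function part of the result.\<close>

lemma has_integral_along_segment:
  fixes f :: "real \<Rightarrow> real" and c d :: real
  assumes "c \<noteq> d" and "f absolutely_integrable_on closed_segment c d"
  shows "((\<lambda>t. f ((1 - t) * c + t * d)) has_integral
           1 / (d - c) * (LINT x=c..d|lebesgue. f x)) {0..1}"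
proof -
  have incr: "((\<lambda>t. g ((1 - t) * p + t * q)) has_integral
                 1 / (q - p) * (LINT x=p..q|lebesgue. g x)) {0..1}"
    if pq: "p < q" and g: "g absolutely_integrable_on {p..q}"
    for g :: "real \<Rightarrow> real" and p q :: real
  proof -
    have "g absolutely_integrable_on {p<..<q}"
      by (rule set_integrable_subset[OF g]) auto
    then have "(g has_integral (LINT x=p..q|lebesgue. g x)) (cbox p q)"
      using has_integral_oriented_lebesgue[of p q g] pq by simp
    from has_integral_affinity'[OF this, of "q - p" p] pq
    have "((\<lambda>t. g ((q - p) * t + p)) has_integral
             1 / (q - p) * (LINT x=p..q|lebesgue. g x)) {0..1}"
      by (simp add: divide_inverse_commute)
    moreover have "(q - p) * t + p = (1 - t) * p + t * q" for t
      by (simp add: algebra_simps)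
    ultimately show ?thesis by simp
  qed
  show ?thesis
  proof (cases "c < d")
    case True
    then show ?thesis using incr[of c d f] assms(2) by (simp add: closed_segment_eq_real_ivl)
  next
    case False
    then have "((\<lambda>t. f ((1 - t) * d + t * c)) has_integral
                  1 / (c - d) * (LINT x=d..c|lebesgue. f x)) (cbox 0 1)"
      using incr[of d c f] assms by (simp add: closed_segment_eq_real_ivl)
    from has_integral_affinity[OF this, of "-1" 1]
    have "((\<lambda>t. f (t * d + (1 - t) * c)) has_integral
             1 / (c - d) * (LINT x=d..c|lebesgue. f x)) {0..1}"
      by simp
    then show ?thesis
      using mean_value_swap[of d c f] by (simp add: add.commute)
  qed
qed

lemma has_integral_reflect_unit:
  fixes g :: "real \<Rightarrow> real"
  assumes "(g has_integral I) {0..1}"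
  shows "((\<lambda>t. g (1 - t)) has_integral I) {0..1}"
  using has_integral_affinity[of g I 0 1 "-1" 1] assms by simp

text \<open>The convexity inequality, with \<open>\<alpha> = 1 - t\<close>, is integrated over the open interval,
  since it is only known for \<open>\<alpha> \<in> {0<..<1}\<close>.\<close>

lemma hm_convex_mean_le:
  fixes h f :: "real \<Rightarrow> real" and m x y H :: real
  assumes conv: "hm_convex h m f"
    and h: "(h has_integral H) {0..1}"
    and "0 \<le> x" and "0 \<le> y" and "x \<noteq> m * y"
    and "f absolutely_integrable_on closed_segment x (m * y)"
  shows "1 / (m * y - x) * (LINT z=x..m * y|lebesgue. f z) \<le> H * (f x + m * f y)"
proof -
  have "((\<lambda>t. f ((1 - t) * x + t * (m * y))) has_integral
          1 / (m * y - x) * (LINT z=x..m * y|lebesgue. f z)) {0<..<1}"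
    using has_integral_along_segment[OF assms(5,6)] by (simp add: has_integral_Icc_iff_Ioo)
  moreover have "((\<lambda>t. h (1 - t) * f x + h t * (m * f y)) has_integral
                   H * f x + H * (m * f y)) {0<..<1}"
    using has_integral_add[OF has_integral_mult_left[OF has_integral_reflect_unit[OF h]]
        has_integral_mult_left[OF h]]
    by (simp add: has_integral_Icc_iff_Ioo)
  moreover have "f ((1 - t) * x + t * (m * y)) \<le> h (1 - t) * f x + h t * (m * f y)"
    if "t \<in> {0<..<1}" for t
  proof -
    have "1 - t \<in> {0<..<1}" using that by simp
    with conv \<open>0 \<le> x\<close> \<open>0 \<le> y\<close>
    have "f ((1 - t) * x + m * (1 - (1 - t)) * y) \<le> h (1 - t) * f x + m * h (1 - (1 - t)) * f y"
      unfolding hm_convex_def by (meson atLeast_iff)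
    then show ?thesis by (simp add: mult_ac)
  qed
  ultimately have "1 / (m * y - x) * (LINT z=x..m * y|lebesgue. f z) \<le> H * f x + H * (m * f y)"
    by (rule has_integral_le)
  then show ?thesis by (simp add: distrib_left)
qed

theorem theorem10:
  fixes J :: "real set" and h f :: "real \<Rightarrow> real" and m a b :: real
  assumes "is_interval J" and "{0<..<1} \<subseteq> J"
    and "\<And>t. t \<in> J \<Longrightarrow> 0 \<le> h t"
    and "set_integrable lebesgue {0<..<1} h"
    and "0 < m" and "m \<le> 1"
    and "hm_convex h m f"
    and "0 \<le> a" and "a < b"
    and "m * b \<noteq> a"
    and "set_integrable lebesgue {m * a..b} f"
  shows "1 / (m + 1) *
           (1 / (m * b - a) * (LINT x=a..m * b|lebesgue. f x)
            + 1 / (b - m * a) * (LINT x=m * a..b|lebesgue. f x))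
         \<le> (f a + f b) / 2 *
           ((LINT t=0..1|lebesgue. h t) + (LINT t=0..1|lebesgue. h (1 - t)))"
proof -
  define H where "H = (LINT t=0..1|lebesgue. h t)"
  have h: "(h has_integral H) {0..1}"
    using has_integral_oriented_lebesgue[OF _ assms(4)] by (simp add: H_def zero_ereal_def one_ereal_def)
  \<comment> \<open>Reflection yields only a Henstock--Kurzweil integral; that \<open>h\<close> is non-negative
    makes it a Lebesgue integral.\<close>
  have H': "(LINT t=0..1|lebesgue. h (1 - t)) = H"
  proof -
    have "(\<lambda>t. h (1 - t)) absolutely_integrable_on {0<..<1}"
    proof (rule nonnegative_absolutely_integrable_1)
      show "(\<lambda>t. h (1 - t)) integrable_on {0<..<1}"
        using has_integral_reflect_unit[OF h] by (auto simp: has_integral_Icc_iff_Ioo)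
      show "0 \<le> h (1 - t)" if "t \<in> {0<..<1}" for t
        using that assms(2,3) by (simp add: subset_iff)
    qed
    from has_integral_oriented_lebesgue[OF _ this]
    have "((\<lambda>t. h (1 - t)) has_integral (LINT t=0..1|lebesgue. h (1 - t))) {0..1}"
      by (simp add: zero_ereal_def one_ereal_def)
    then show ?thesis
      using has_integral_reflect_unit[OF h] has_integral_unique by blast
  qed
  have "m * a \<le> a" and "m * b \<le> b" and "m * a \<le> m * b"
    using assms(5,6,8,9) by (auto simp: mult_left_le_one_le)
  then have "closed_segment a (m * b) \<subseteq> {m * a..b}" and "closed_segment b (m * a) \<subseteq> {m * a..b}"
    and "m * a < b"
    using assms(9) by (auto simp: closed_segment_eq_real_ivl)
  then have f: "f absolutely_integrable_on closed_segment a (m * b)"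
      "f absolutely_integrable_on closed_segment b (m * a)"
    using assms(11) by (auto intro: set_integrable_subset)
  have "1 / (m * b - a) * (LINT x=a..m * b|lebesgue. f x) \<le> H * (f a + m * f b)"
    using hm_convex_mean_le[OF assms(7) h _ _ _ f(1)] assms(8-10) by auto
  moreover have "1 / (b - m * a) * (LINT x=m * a..b|lebesgue. f x) \<le> H * (f b + m * f a)"
    using hm_convex_mean_le[OF assms(7) h _ _ _ f(2)] assms(8,9) \<open>m * a < b\<close>
    unfolding mean_value_swap[of b "m * a" f] by auto
  ultimately have "1 / (m * b - a) * (LINT x=a..m * b|lebesgue. f x)
      + 1 / (b - m * a) * (LINT x=m * a..b|lebesgue. f x)
      \<le> (m + 1) * (H * (f a + f b))"
    by (simp add: algebra_simps)
  then have "1 / (m + 1) * (1 / (m * b - a) * (LINT x=a..m * b|lebesgue. f x)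
      + 1 / (b - m * a) * (LINT x=m * a..b|lebesgue. f x))
      \<le> 1 / (m + 1) * ((m + 1) * (H * (f a + f b)))"
    using assms(5) by (intro mult_left_mono) auto
  also have "\<dots> = (f a + f b) / 2 * (H + H)"
    using assms(5) by (simp add: field_simps)
  finally show ?thesis by (simp only: H' H_def[symmetric])
qed

end
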